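(* Let $W$ be a radial weight that is non-increasing on $(0,\infty)$. Then the Korenblum radius of $F^2_W$ equals $\sqrt{m_1/m_0}$, and this radius is admissible for $F^2_W$.
   Context: A radial weight is a measurable function $W\ge0$ on $[0,\infty)$, not almost everywhere zero, whose moments $m_k=\int_0^\infty t^kW(t)\,dt$, $k=0,1,2,\dots$, are all finite. $F^2_W$ is the space of entire functions $f$ with $\|f\|_W^2=\frac1\pi\int_{\mathbb C}|f(z)|^2W(|z|^2)\,dA(z)<\infty$, where $dA$ is area measure on $\mathbb C$. A radius $R>0$ is admissible for $F^2_W$ if $\|f\|_W\le\|g\|_W$ for all $f,g\in F^2_W$ with $|f(z)|\le|g(z)|$ for $|z|>R$. The Korenblum radius of $F^2_W$ is the supremum of the admissible radii. *)

theory Defs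
  imports "HOL-Complex_Analysis.Complex_Analysis"
begin

text \<open>
  A weight is a total function on the reals of which only the restriction to
  \<open>[0, \<infinity>)\<close> matters. Measurability is Lebesgue measurability throughout, and
  \<open>dA\<close> is Lebesgue measure on the complex plane.
\<close>

definition radial_weight :: "(real \<Rightarrow> real) \<Rightarrow> bool" where
  "radial_weight W \<longleftrightarrow>
     W \<in> borel_measurable (lebesgue_on {0..}) \<and>
     (\<forall>t\<ge>0. 0 \<le> W t) \<and>
     \<not> (AE t in lebesgue_on {0..}. W t = 0) \<and>
     (\<forall>k::nat. integrable (lebesgue_on {0..}) (\<lambda>t. t ^ k * W t))"

definition weight_moment :: "(real \<Rightarrow> real) \<Rightarrow> nat \<Rightarrow> real" where
  "weight_moment W k = (\<integral>t. t ^ k * W t \<partial>lebesgue_on {0..})"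

definition fock_space :: "(real \<Rightarrow> real) \<Rightarrow> (complex \<Rightarrow> complex) set" where
  "fock_space W =
     {f. f holomorphic_on UNIV \<and>
         integrable lebesgue (\<lambda>z. (cmod (f z))\<^sup>2 * W ((cmod z)\<^sup>2))}"

definition fock_norm :: "(real \<Rightarrow> real) \<Rightarrow> (complex \<Rightarrow> complex) \<Rightarrow> real" where
  "fock_norm W f =
     sqrt (1 / pi * (\<integral>z. (cmod (f z))\<^sup>2 * W ((cmod z)\<^sup>2) \<partial>lebesgue))"

definition admissible_radius :: "(real \<Rightarrow> real) \<Rightarrow> real \<Rightarrow> bool" where
  "admissible_radius W R \<longleftrightarrow>
     R > 0 \<and>
     (\<forall>f\<in>fock_space W. \<forall>g\<in>fock_space W.
        (\<forall>z. cmod z > R \<longrightarrow> cmod (f z) \<le> cmod (g z)) \<longrightarrow> fock_norm W f \<le> fock_norm W g)"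

text \<open>
  The supremum is taken in the extended reals, so that it does not take an
  unspecified value when the set of admissible radii is empty or unbounded.
\<close>

definition korenblum_radius :: "(real \<Rightarrow> real) \<Rightarrow> ereal" where
  "korenblum_radius W = (SUP R\<in>{R. admissible_radius W R}. ereal R)"

end

theory Submission
  imports Defs
begin

text \<open>
  Write \<open>R\<^sup>2 = m\<^sub>1 / m\<^sub>0\<close>. Comparing the constant \<open>r\<close> with the function \<open>z\<close> shows that no radius
  \<open>r > R\<close> is admissible. For the converse let \<open>\<bar>f\<bar> \<le> \<bar>g\<bar>\<close> for \<open>\<bar>z\<bar> > R\<close>, with Taylor coefficients
  \<open>a\<^sub>k\<close> and \<open>b\<^sub>k\<close>. Then \<open>u = f / g\<close> is holomorphic and bounded by 1 outside the disc, including
  infinity, so multiplication by \<open>u\<close> does not raise the degree of a polynomial. Hence the tail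
  \<open>f\<^sub>j = \<Sum>k\<ge>j. a\<^sub>k z\<^sup>k\<close> is the projection of \<open>u g\<^sub>j\<close> onto the powers of degree at least \<open>j\<close> on
  every circle of radius \<open>r > R\<close>, and Parseval's identity yields
  \<open>\<Sum>k\<ge>j. \<bar>a\<^sub>k\<bar>\<^sup>2 R\<^bsup>2k\<^esup> \<le> \<Sum>k\<ge>j. \<bar>b\<^sub>k\<bar>\<^sup>2 R\<^bsup>2k\<^esup>\<close> for every \<open>j\<close>. Chebyshev's inequality shows that
  \<open>m\<^sub>k / R\<^bsup>2k\<^esup>\<close> is non-decreasing in \<open>k\<close>, so Abel summation turns these tail inequalities into
  \<open>\<Sum>k. m\<^sub>k \<bar>a\<^sub>k\<bar>\<^sup>2 \<le> \<Sum>k. m\<^sub>k \<bar>b\<^sub>k\<bar>\<^sup>2\<close>, which compares the squares of the norms.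
\<close>

unbundle no fps_syntax

section \<open>Area measure on the complex plane\<close>

text \<open>This identification transports facts about orthogonal transformations of
  \<open>real^2\<close>, which preserve Lebesgue measure, to area measure on
  \<open>complex\<close>.\<close>

definition complex_of_vec :: "real^2 \<Rightarrow> complex" where
  "complex_of_vec x = Complex (x $ 1) (x $ 2)"

definition vec_of_complex :: "complex \<Rightarrow> real^2" where
  "vec_of_complex z = (\<chi> i. if i = 1 then Re z else Im z)"

lemma complex_of_vec_inverse [simp]:
  "complex_of_vec (vec_of_complex z) = z" "vec_of_complex (complex_of_vec x) = x"
  by (auto simp: complex_of_vec_def vec_of_complex_def vec_eq_iff forall_2 complex_eq_iff)

lemma norm_vec_of_complex [simp]: "norm (vec_of_complex z) = cmod z"
  by (simp add: norm_vec_def L2_set_def sum_2 vec_of_complex_def cmod_def)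

lemma norm_complex_of_vec [simp]: "cmod (complex_of_vec x) = norm x"
  by (metis complex_of_vec_inverse(2) norm_vec_of_complex)

lemma linear_vec_of_complex: "linear vec_of_complex"
  by (rule linearI) (auto simp: vec_of_complex_def vec_eq_iff)

lemma linear_complex_of_vec: "linear complex_of_vec"
  by (rule linearI) (auto simp: complex_of_vec_def complex_eq_iff)

lemma borel_measurable_vec_of_complex [measurable]: "vec_of_complex \<in> borel_measurable borel"
  using linear_vec_of_complex by (intro borel_measurable_continuous_onI linear_continuous_on)
    (simp add: linear_linear)

lemma borel_measurable_complex_of_vec [measurable]: "complex_of_vec \<in> borel_measurable borel"
  using linear_complex_of_vec by (intro borel_measurable_continuous_onI linear_continuous_on)
    (simp add: linear_linear)

text \<open>Lebesgue measure is determined by its values on open boxes, and the identification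
  carries boxes to boxes with the same side lengths.\<close>

lemma distr_vec_of_complex: "distr lborel borel vec_of_complex = lborel"
proof (rule lborel_eqI[symmetric])
  fix l u :: "real^2"
  assume lu: "\<And>b. b \<in> Basis \<Longrightarrow> l \<bullet> b \<le> u \<bullet> b"
  have le: "l $ i \<le> u $ i" for i
    using lu[of "axis i 1"] by (simp add: inner_axis)
  have eq: "vec_of_complex -` box l u = box (complex_of_vec l) (complex_of_vec u)"
    by (auto simp: mem_box_cart forall_2 vec_of_complex_def complex_of_vec_def in_box_complex_iff)
  have Basis_eq: "(Basis :: (real^2) set) = {axis 1 1, axis 2 1}"
    by (auto simp: Basis_vec_def UNIV_2)
  have "axis 1 1 \<noteq> (axis 2 1 :: real^2)" by (simp add: axis_eq_axis)
  then have "(\<Prod>b\<in>Basis. (u - l) \<bullet> b) = (u $ 1 - l $ 1) * (u $ 2 - l $ 2)"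
    unfolding Basis_eq by (subst prod.insert) (auto simp: inner_axis)
  moreover have "emeasure lborel (box (complex_of_vec l) (complex_of_vec u)) =
      ennreal ((u $ 1 - l $ 1) * (u $ 2 - l $ 2))"
    by (subst emeasure_lborel_box)
       (auto simp: complex_of_vec_def Basis_complex_def le)
  ultimately show "emeasure (distr lborel borel vec_of_complex) (box l u) =
      ennreal (\<Prod>b\<in>Basis. (u - l) \<bullet> b)"
    by (simp add: emeasure_distr eq)
qed simp

text \<open>Testing on open boxes suffices. Read in \<open>real^2\<close>, the preimage of a box
  under a rotation is the image of a box under the inverse rotation, and orthogonal images keep
  their measure.\<close>

lemma distr_lborel_rotation:
  fixes c :: complex
  assumes c: "cmod c = 1"
  shows "distr lborel borel (\<lambda>z. c * z) = lborel"
proof (rule lborel_eqI[symmetric])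
  fix l u :: complex
  assume lu: "\<And>b. b \<in> Basis \<Longrightarrow> l \<bullet> b \<le> u \<bullet> b"
  define T where "T x = vec_of_complex (cnj c * complex_of_vec x)" for x
  have cc: "cnj c * c = 1" using complex_norm_square[of c] c by (simp add: mult.commute)
  then have cancel: "c * (cnj c * w) = w" "cnj c * (c * w) = w" for w
    by (metis mult.assoc mult.commute mult_1)+
  have T: "orthogonal_transformation T"
    unfolding orthogonal_transformation
  proof
    have "linear (\<lambda>z. cnj c * z)" by (simp add: linear_times)
    from linear_compose[OF linear_compose[OF linear_complex_of_vec this] linear_vec_of_complex]
    show "linear T" by (simp add: o_def T_def[abs_def])
    show "\<forall>v. norm (T v) = norm v" by (simp add: T_def norm_mult c)
  qed
  define B where "B = complex_of_vec -` box l u"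
  have B: "B = box (vec_of_complex l) (vec_of_complex u)"
    by (auto simp: B_def mem_box_cart forall_2 vec_of_complex_def complex_of_vec_def in_box_complex_iff)
  have Bm: "B \<in> lmeasurable" by (simp add: B)
  have im: "T ` B = complex_of_vec -` ((\<lambda>z. c * z) -` box l u)"
  proof (intro equalityI subsetI)
    fix x assume "x \<in> T ` B"
    then show "x \<in> complex_of_vec -` ((\<lambda>z. c * z) -` box l u)"
      by (auto simp: T_def B_def cancel)
  next
    fix x assume x: "x \<in> complex_of_vec -` ((\<lambda>z. c * z) -` box l u)"
    have "x = T (vec_of_complex (c * complex_of_vec x))"
      by (simp add: T_def cancel)
    moreover have "vec_of_complex (c * complex_of_vec x) \<in> B"
      using x by (simp add: B_def)
    ultimately show "x \<in> T ` B" by blast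
  qed
  have TB: "T ` B \<in> lmeasurable" "measure lebesgue (T ` B) = measure lebesgue B"
    using measurable_orthogonal_image[OF T Bm] measure_orthogonal_image[OF T Bm] by auto
  have vol: "emeasure lborel S = emeasure lebesgue (complex_of_vec -` S)" if "S \<in> sets borel" for S
  proof -
    have S: "complex_of_vec -` S \<in> sets borel"
      using measurable_sets[OF borel_measurable_complex_of_vec that] by simp
    then have "emeasure lebesgue (complex_of_vec -` S) = emeasure (distr lborel borel vec_of_complex) (complex_of_vec -` S)"
      by (simp add: distr_vec_of_complex)
    also have "\<dots> = emeasure lborel (vec_of_complex -` (complex_of_vec -` S))"
      using S by (simp add: emeasure_distr)
    also have "vec_of_complex -` (complex_of_vec -` S) = S" by auto
    finally show ?thesis ..
  qed
  have m: "(\<lambda>z. c * z) -` box l u \<in> sets borel"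
    using measurable_sets[of "(\<lambda>z. c * z)" borel borel "box l u"] by simp
  have "emeasure (distr lborel borel (\<lambda>z. c * z)) (box l u) = emeasure lborel ((\<lambda>z. c * z) -` box l u)"
    by (simp add: emeasure_distr)
  also have "\<dots> = emeasure lebesgue (T ` B)" by (simp only: vol[OF m] im)
  also have "\<dots> = emeasure lebesgue B"
    by (simp only: emeasure_eq_measure2[OF TB(1)] emeasure_eq_measure2[OF Bm] TB(2))
  also have "\<dots> = emeasure lborel (box l u)" unfolding B_def by (rule vol[symmetric]) simp
  also have "\<dots> = ennreal (\<Prod>b\<in>Basis. (u - l) \<bullet> b)" using lu by (simp add: emeasure_lborel_box)
  finally show "emeasure (distr lborel borel (\<lambda>z. c * z)) (box l u) = ennreal (\<Prod>b\<in>Basis. (u - l) \<bullet> b)" .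
qed simp

lemma nn_integral_lborel_rotation:
  fixes c :: complex
  assumes c: "cmod c = 1" and f: "f \<in> borel_measurable borel"
  shows "(\<integral>\<^sup>+z. f (c * z) \<partial>lborel) = (\<integral>\<^sup>+z. f z \<partial>lborel)"
proof -
  have "(\<integral>\<^sup>+z. f z \<partial>lborel) = (\<integral>\<^sup>+z. f z \<partial>distr lborel borel (\<lambda>z. c * z))"
    by (simp add: distr_lborel_rotation[OF c])
  also have "\<dots> = (\<integral>\<^sup>+z. f (c * z) \<partial>lborel)"
    by (rule nn_integral_distr) (use f in auto)
  finally show ?thesis ..
qed

text \<open>The set where the squared modulus is at most \<open>a\<close> is a disc of area
  \<open>pi * a\<close> for \<open>a\<close> at least 0. This is linear in \<open>a\<close>, so the
  image measure has constant density on the half-line. The sets \<open>{..a}\<close> form an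
  intersection-stable generator, which settles all Borel sets.\<close>

lemma distr_cmod_power2:
  "distr lborel borel (\<lambda>z. (cmod z)\<^sup>2) = density lborel (\<lambda>t. ennreal pi * indicator {0..} t)"
proof (rule measure_eqI_generator_eq[where E = "range atMost" and \<Omega> = UNIV and A = "\<lambda>n. {..real n}"])
  have E: "emeasure (distr lborel borel (\<lambda>z. (cmod z)\<^sup>2)) {..a} = ennreal (pi * max 0 a)" for a
  proof (cases "a < 0")
    case True
    have "(\<lambda>z::complex. (cmod z)\<^sup>2) -` {..a} = {}"
      using True by (auto dest: order_trans[OF zero_le_power2])
    then show ?thesis using True by (simp add: emeasure_distr max_def)
  next
    case False
    have "(\<lambda>z::complex. (cmod z)\<^sup>2) -` {..a} = cball 0 (sqrt a)"
      using False real_le_rsqrt real_sqrt_le_iff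
      by (auto simp: real_le_rsqrt) (metis norm_ge_zero real_sqrt_le_iff real_sqrt_pow2_iff real_sqrt_power real_sqrt_unique)
    then show ?thesis using False
      by (simp add: emeasure_distr emeasure_cball unit_ball_vol_2 max_def mult.commute)
  qed
  have F: "emeasure (density lborel (\<lambda>t. ennreal pi * indicator {0..} t)) {..a} = ennreal (pi * max 0 a)" for a
  proof -
    have "emeasure (density lborel (\<lambda>t. ennreal pi * indicator {0..} t)) {..a} =
        (\<integral>\<^sup>+t. ennreal pi * indicator {0..max 0 a} t * indicator {..a} t \<partial>lborel)"
      by (subst emeasure_density) (auto intro!: nn_integral_cong simp: indicator_def)
    also have "\<dots> = (\<integral>\<^sup>+t. ennreal pi * indicator {0..a} t \<partial>lborel)"
      by (intro nn_integral_cong) (auto simp: indicator_def)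
    also have "\<dots> = ennreal pi * emeasure lborel {0..a}"
      by (simp add: nn_integral_cmult)
    also have "\<dots> = ennreal (pi * max 0 a)"
      by (cases "a < 0") (auto simp: max_def ennreal_mult)
    finally show ?thesis .
  qed
  show "emeasure (distr lborel borel (\<lambda>z. (cmod z)\<^sup>2)) X =
      emeasure (density lborel (\<lambda>t. ennreal pi * indicator {0..} t)) X" if "X \<in> range atMost" for X
    using that E F by auto
  show "Int_stable (range (atMost :: real \<Rightarrow> _))" by (rule Int_stableI) auto
  have "sets (borel :: real measure) = sigma_sets UNIV (range atMost)"
    by (subst borel_eq_atMost, rule sets_measure_of) simp
  then show "sets (distr lborel borel (\<lambda>z. (cmod z)\<^sup>2)) = sigma_sets UNIV (range atMost)"
    "sets (density lborel (\<lambda>t::real. ennreal pi * indicator {0..} t)) = sigma_sets UNIV (range atMost)"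
    by simp_all
  show "(\<Union>n. {..real n}) = UNIV" using real_arch_simple by auto
  show "emeasure (distr lborel borel (\<lambda>z. (cmod z)\<^sup>2)) {..real n} \<noteq> \<infinity>" for n using E by simp
qed auto

lemma nn_integral_radial:
  assumes "f \<in> borel_measurable borel"
  shows "(\<integral>\<^sup>+z. f ((cmod z)\<^sup>2) \<partial>lborel) = ennreal pi * (\<integral>\<^sup>+t. f t * indicator {0..} t \<partial>lborel)"
proof -
  have "(\<integral>\<^sup>+z. f ((cmod z)\<^sup>2) \<partial>lborel) = (\<integral>\<^sup>+t. f t \<partial>distr lborel borel (\<lambda>z. (cmod z)\<^sup>2))"
    using assms by (simp add: nn_integral_distr)
  also have "\<dots> = (\<integral>\<^sup>+t. ennreal pi * (f t * indicator {0..} t) \<partial>lborel)"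
    using assms by (simp add: distr_cmod_power2 nn_integral_density mult_ac)
  also have "\<dots> = ennreal pi * (\<integral>\<^sup>+t. f t * indicator {0..} t \<partial>lborel)"
    using assms by (simp add: nn_integral_cmult)
  finally show ?thesis .
qed

section \<open>Means over circles\<close>

text \<open>With the parametrisation \<open>cis (2 * pi * t)\<close>, integration against this
  probability measure is the normalised mean over the unit circle.\<close>

abbreviation unit_interval_measure :: "real measure" where
  "unit_interval_measure \<equiv> uniform_measure lborel {0..1}"

lemma emeasure_unit_interval_UNIV: "emeasure unit_interval_measure UNIV = 1"
  by simp

lemma finite_measure_unit_interval: "finite_measure unit_interval_measure"
  by (rule finite_measureI) simp

lemma continuous_on_circle:
  assumes "continuous_on (sphere 0 1) H"
  shows "continuous_on UNIV (\<lambda>t::real. H (cis (2 * pi * t)))"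
  by (rule continuous_on_compose2[OF assms]) (auto intro!: continuous_intros)

lemma borel_measurable_circle:
  fixes H :: "complex \<Rightarrow> 'a::{banach, second_countable_topology}"
  assumes "continuous_on (sphere 0 1) H"
  shows "(\<lambda>t. H (cis (2 * pi * t))) \<in> borel_measurable borel"
  using continuous_on_circle[OF assms] by (rule borel_measurable_continuous_onI)

lemma integrable_circle:
  fixes H :: "complex \<Rightarrow> 'a::{banach, second_countable_topology}"
  assumes "continuous_on (sphere 0 1) H"
  shows "integrable unit_interval_measure (\<lambda>t. H (cis (2 * pi * t)))"
proof -
  interpret finite_measure unit_interval_measure by (rule finite_measure_unit_interval)
  have "bounded (H ` sphere 0 1)"
    using assms by (intro compact_imp_bounded compact_continuous_image) auto
  then obtain B where "\<And>z. z \<in> sphere 0 1 \<Longrightarrow> norm (H z) \<le> B"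
    unfolding bounded_iff by blast
  then have "norm (H (cis (2 * pi * t))) \<le> B" for t by simp
  then show ?thesis
    using borel_measurable_circle[OF assms] by (intro integrable_const_bound[where B = B]) auto
qed

text \<open>This is Cauchy's integral formula at the centre: the derivative of the parametrisation
  cancels the kernel \<open>1 / u\<close> up to the factor \<open>2 * pi * \<i>\<close>.\<close>

lemma circle_mean_value:
  assumes "H holomorphic_on ball 0 s" "s > 1"
  shows "(\<integral>t. H (cis (2 * pi * t)) \<partial>unit_interval_measure) = H 0"
proof -
  have hol: "H holomorphic_on cball 0 1" using assms by (auto elim!: holomorphic_on_subset)
  have "((\<lambda>u. H u / (u - 0)) has_contour_integral (2 * of_real pi * \<i> * H 0)) (circlepath 0 1)"
    by (rule Cauchy_integral_circlepath_simple) (use hol in auto)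
  moreover have eq: "H (circlepath 0 1 t) / (circlepath 0 1 t - 0) * vector_derivative (circlepath 0 1) (at t) =
      2 * of_real pi * \<i> * H (cis (2 * pi * t))" if "t \<in> {0..1}" for t
  proof -
    have "circlepath 0 1 t = cis (2 * pi * t)"
      by (simp add: circlepath cis_conv_exp mult_ac)
    moreover have "vector_derivative (circlepath 0 1) (at t) = 2 * of_real pi * \<i> * cis (2 * pi * t)"
      by (simp add: vector_derivative_circlepath cis_conv_exp mult_ac)
    ultimately show ?thesis by (simp add: field_simps)
  qed
  ultimately have "((\<lambda>t. 2 * of_real pi * \<i> * H (cis (2 * pi * t))) has_integral (2 * of_real pi * \<i> * H 0)) {0..1}"
    unfolding has_contour_integral by (intro has_integral_eq[OF eq])
  then have "((\<lambda>t. (2 * of_real pi * \<i> * H (cis (2 * pi * t))) / (2 * of_real pi * \<i>)) has_integral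
      (2 * of_real pi * \<i> * H 0) / (2 * of_real pi * \<i>)) {0..1}"
    by (rule has_integral_divide)
  then have 1: "((\<lambda>t. H (cis (2 * pi * t))) has_integral H 0) {0..1}" by simp
  have cont: "continuous_on (sphere 0 1) H"
    using hol by (auto intro: holomorphic_on_imp_continuous_on continuous_on_subset)
  have "set_integrable lborel {0..1} (\<lambda>t. H (cis (2 * pi * t)))"
    using continuous_on_circle[OF cont]
    by (intro borel_integrable_atLeastAtMost') (auto intro: continuous_on_subset)
  from set_borel_integral_eq_integral(2)[OF this] 1
  have "(LINT t:{0..1}|lborel. H (cis (2 * pi * t))) = H 0"
    by (simp add: integral_unique)
  moreover have "(\<integral>t. H (cis (2 * pi * t)) \<partial>unit_interval_measure) =
      (LINT t:{0..1}|lborel. H (cis (2 * pi * t)))"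
  proof -
    have "unit_interval_measure = density lborel (\<lambda>t. ennreal (indicator {0..1} t))"
      by (simp add: uniform_measure_def ennreal_indicator divide_ennreal_def)
    then show ?thesis
      using borel_measurable_circle[OF cont]
      by (simp add: integral_density set_lebesgue_integral_def)
  qed
  ultimately show ?thesis by simp
qed

text \<open>On the circle conjugation inverts, so for \<open>k \<le> i\<close> the integrand is the
  power \<open>i - k\<close>, whose mean is its value \<open>0 ^ (i - k)\<close> at the centre.
  Conjugation exchanges the two exponents and gives the other case.\<close>

lemma circle_orthonormal:
  "(\<integral>t. cis (2 * pi * t) ^ i * cnj (cis (2 * pi * t) ^ k) \<partial>unit_interval_measure) =
     (if i = k then 1 else 0)"
proof -
  have main: "(\<integral>t. cis (2 * pi * t) ^ i * cnj (cis (2 * pi * t) ^ k) \<partial>unit_interval_measure) =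
     (if i = k then 1 else 0)" if "k \<le> i" for i k
  proof -
    have "cis x ^ i * cnj (cis x ^ k) = cis x ^ (i - k)" for x
    proof -
      have "cis x ^ i = cis x ^ (i - k) * cis x ^ k" using that by (simp flip: power_add)
      moreover have "cis x ^ k * cnj (cis x ^ k) = 1"
        by (simp add: cis_cnj cis_mult flip: power_mult_distrib)
      ultimately show ?thesis by (simp only: mult.assoc) simp
    qed
    then have "(\<integral>t. cis (2 * pi * t) ^ i * cnj (cis (2 * pi * t) ^ k) \<partial>unit_interval_measure) =
      (\<integral>t. cis (2 * pi * t) ^ (i - k) \<partial>unit_interval_measure)" by simp
    also have "\<dots> = 0 ^ (i - k)"
      by (rule circle_mean_value[where s = 2]) (auto intro!: holomorphic_intros)
    finally show ?thesis using that by (simp add: power_0_left)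
  qed
  show ?thesis
  proof (cases "k \<le> i")
    case False
    have "(\<integral>t. cis (2 * pi * t) ^ i * cnj (cis (2 * pi * t) ^ k) \<partial>unit_interval_measure) =
      (\<integral>t. cnj (cis (2 * pi * t) ^ k * cnj (cis (2 * pi * t) ^ i)) \<partial>unit_interval_measure)"
      by (simp add: mult.commute)
    also have "\<dots> = cnj (if k = i then 1 else 0)"
      using False by (simp only: Bochner_Integration.integral_cnj main)
    finally show ?thesis by auto
  qed (rule main)
qed

section \<open>Parseval's identity on circles\<close>

text \<open>Absolute summability of the coefficients allows termwise integration twice: first to
  recover each \<open>c k\<close> as the mean of \<open>F\<close> against the conjugate power, then
  to integrate \<open>F * cnj F\<close> with the second factor expanded.\<close>

lemma parseval_circle_unit:
  assumes sum: "\<And>z. cmod z = 1 \<Longrightarrow> (\<lambda>k. c k * z ^ k) sums F z"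
    and summ: "summable (\<lambda>k. cmod (c k))" and cont: "continuous_on (sphere 0 1) F"
  shows "(\<lambda>k. (cmod (c k))\<^sup>2) sums (\<integral>t. (cmod (F (cis (2 * pi * t))))\<^sup>2 \<partial>unit_interval_measure)"
proof -
  let ?e = "\<lambda>t::real. cis (2 * pi * t)"
  interpret finite_measure unit_interval_measure by (rule finite_measure_unit_interval)
  have meas1: "measure unit_interval_measure UNIV = 1" by (simp add: measure_def)
  have coeff: "(\<integral>t. F (?e t) * cnj (?e t ^ k) \<partial>unit_interval_measure) = c k" for k
  proof -
    have "(\<lambda>i. \<integral>t. c i * (?e t ^ i * cnj (?e t ^ k)) \<partial>unit_interval_measure) sums
        (\<integral>t. (\<Sum>i. c i * (?e t ^ i * cnj (?e t ^ k))) \<partial>unit_interval_measure)"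
    proof (rule sums_integral)
      show "integrable unit_interval_measure (\<lambda>t. c i * (?e t ^ i * cnj (?e t ^ k)))" for i
        by (rule integrable_circle[of "\<lambda>z. c i * (z ^ i * cnj (z ^ k))"]) (intro continuous_intros)
    qed (use summ meas1 in \<open>auto simp: norm_mult norm_power\<close>)
    moreover have "(\<lambda>t. \<Sum>i. c i * (?e t ^ i * cnj (?e t ^ k))) = (\<lambda>t. F (?e t) * cnj (?e t ^ k))"
    proof
      fix t
      have "(\<lambda>i. c i * ?e t ^ i * cnj (?e t ^ k)) sums (F (?e t) * cnj (?e t ^ k))"
        by (intro sums_mult2 sum) simp
      then show "(\<Sum>i. c i * (?e t ^ i * cnj (?e t ^ k))) = F (?e t) * cnj (?e t ^ k)"
        by (simp add: sums_iff mult.assoc)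
    qed
    ultimately have "(\<lambda>i. if i = k then c i else 0) sums
        (\<integral>t. F (?e t) * cnj (?e t ^ k) \<partial>unit_interval_measure)"
      by (simp add: circle_orthonormal if_distrib cong: if_cong del: complex_cnj_power)
    moreover have "(\<lambda>i. if i = k then c i else 0) sums c k" by (rule sums_single)
    ultimately show ?thesis using sums_unique2 by blast
  qed
  have "bounded (F ` sphere 0 1)"
    using cont by (intro compact_imp_bounded compact_continuous_image) auto
  then obtain B where B: "\<And>z. z \<in> sphere 0 1 \<Longrightarrow> cmod (F z) \<le> B"
    unfolding bounded_iff by blast
  have le: "cmod (F (?e t)) \<le> B" for t by (rule B) simp
  then have "0 \<le> B" using norm_ge_zero order_trans by blast
  have intF: "integrable unit_interval_measure (\<lambda>t. F (?e t) * cnj (c k * ?e t ^ k))" for k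
    by (rule integrable_circle[of "\<lambda>z. F z * cnj (c k * z ^ k)"]) (intro continuous_intros cont)
  have bd: "norm (F (?e t) * cnj (c k * ?e t ^ k)) \<le> B * cmod (c k)" for t k
    using le[of t] by (simp add: norm_mult norm_power mult_right_mono)
  have sB: "summable (\<lambda>k. B * cmod (c k))" using summ by (rule summable_mult)
  have "(\<lambda>k. \<integral>t. F (?e t) * cnj (c k * ?e t ^ k) \<partial>unit_interval_measure) sums
        (\<integral>t. (\<Sum>k. F (?e t) * cnj (c k * ?e t ^ k)) \<partial>unit_interval_measure)"
  proof (rule sums_integral[OF intF])
    show "AE t in unit_interval_measure. summable (\<lambda>k. norm (F (?e t) * cnj (c k * ?e t ^ k)))"
      using bd by (intro AE_I2 summable_comparison_test[OF _ sB]) auto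
    have "(\<integral>t. norm (F (?e t) * cnj (c k * ?e t ^ k)) \<partial>unit_interval_measure) \<le> B * cmod (c k)" for k
    proof -
      have "(\<integral>t. norm (F (?e t) * cnj (c k * ?e t ^ k)) \<partial>unit_interval_measure)
         \<le> (\<integral>t. B * cmod (c k) \<partial>unit_interval_measure)"
        using integrable_norm[OF intF] bd by (intro integral_mono) auto
      then show ?thesis by (simp add: meas1)
    qed
    then show "summable (\<lambda>k. \<integral>t. norm (F (?e t) * cnj (c k * ?e t ^ k)) \<partial>unit_interval_measure)"
      by (intro summable_comparison_test[OF _ sB]) auto
  qed
  moreover have "(\<lambda>t. \<Sum>k. F (?e t) * cnj (c k * ?e t ^ k)) = (\<lambda>t. of_real ((cmod (F (?e t)))\<^sup>2))"
  proof
    fix t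
    have "(\<lambda>k. F (?e t) * cnj (c k * ?e t ^ k)) sums (F (?e t) * cnj (F (?e t)))"
      using sum[of "?e t"] by (intro sums_mult) (simp only: sums_cnj, simp)
    then show "(\<Sum>k. F (?e t) * cnj (c k * ?e t ^ k)) = of_real ((cmod (F (?e t)))\<^sup>2)"
      by (simp only: sums_iff complex_norm_square)
  qed
  moreover have "(\<integral>t. F (?e t) * cnj (c k * ?e t ^ k) \<partial>unit_interval_measure) = of_real ((cmod (c k))\<^sup>2)" for k
  proof -
    have "(\<integral>t. F (?e t) * cnj (c k * ?e t ^ k) \<partial>unit_interval_measure) =
       (\<integral>t. cnj (c k) * (F (?e t) * cnj (?e t ^ k)) \<partial>unit_interval_measure)"
      by (simp add: mult_ac)
    also have "\<dots> = cnj (c k) * c k" by (subst integral_mult_right_zero) (simp only: coeff)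
    finally show ?thesis by (simp only: complex_norm_square mult.commute)
  qed
  ultimately have "(\<lambda>k. of_real ((cmod (c k))\<^sup>2) :: complex) sums
      of_real (\<integral>t. (cmod (F (?e t)))\<^sup>2 \<partial>unit_interval_measure)"
    by (simp add: integral_complex_of_real del: of_real_power)
  then show ?thesis by (simp only: sums_of_real_iff)
qed

lemma entire_power_series:
  assumes "\<And>z. (\<lambda>k. a k * z ^ k) sums f z"
  shows "f holomorphic_on UNIV" "\<And>r. summable (\<lambda>k. cmod (a k) * r ^ k)"
proof -
  have hol: "f holomorphic_on ball 0 r" for r
    by (rule power_series_holomorphic[where a = a]) (simp add: assms)
  have "f field_differentiable at z" for z
    by (rule holomorphic_on_imp_differentiable_at[OF hol[of "cmod z + 1"]]) auto
  then show "f holomorphic_on UNIV"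
    by (simp add: holomorphic_on_def)
  show "summable (\<lambda>k. cmod (a k) * r ^ k)" for r
  proof -
    \<comment> \<open>Convergence at a point of modulus larger than \<open>\<bar>r\<bar>\<close>
      forces absolute convergence at \<open>r\<close>.\<close>
    have "summable (\<lambda>k. a k * complex_of_real (\<bar>r\<bar> + 1) ^ k)" using assms by (auto simp: sums_iff)
    from powser_insidea[OF this, of "complex_of_real r"]
    have "summable (\<lambda>k. cmod (a k * complex_of_real r ^ k))" by (simp add: norm_of_real)
    then have "summable (\<lambda>k. norm (cmod (a k) * r ^ k))" by (simp add: norm_mult norm_power abs_mult power_abs)
    then show ?thesis by (rule summable_norm_cancel)
  qed
qed

lemma parseval_circle:
  assumes "\<And>z. (\<lambda>k. a k * z ^ k) sums f z"
  shows "(\<lambda>k. (cmod (a k))\<^sup>2 * cmod z ^ (2 * k)) sums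
     (\<integral>t. (cmod (f (cis (2 * pi * t) * z)))\<^sup>2 \<partial>unit_interval_measure)"
proof -
  have "(\<lambda>k. (cmod (a k * z ^ k))\<^sup>2) sums
     (\<integral>t. (cmod (f (cis (2 * pi * t) * z)))\<^sup>2 \<partial>unit_interval_measure)"
  proof (rule parseval_circle_unit[where F = "\<lambda>w. f (w * z)"])
    show "(\<lambda>k. a k * z ^ k * w ^ k) sums f (w * z)" for w
      using assms[of "w * z"] by (simp add: power_mult_distrib mult_ac)
    show "summable (\<lambda>k. cmod (a k * z ^ k))"
      using entire_power_series(2)[OF assms, of "cmod z"] by (simp add: norm_mult norm_power)
    have "continuous_on UNIV f"
      using entire_power_series(1)[OF assms] by (rule holomorphic_on_imp_continuous_on)
    then show "continuous_on (sphere 0 1) (\<lambda>w. f (w * z))"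
      by (rule continuous_on_compose2) (auto intro!: continuous_intros)
  qed
  then show ?thesis
    by (simp add: norm_mult norm_power power_mult_distrib power_mult[symmetric] mult.commute[of _ 2])
qed

section \<open>Weighted area integrals of entire functions\<close>

text \<open>Distinct powers of \<open>z\<close> are orthogonal for every radial weight. Working with
  extended non-negative integrals makes one identity serve both for membership in the space and for
  the value of the norm.\<close>

lemma nn_integral_entire_radial:
  assumes a: "\<And>z. (\<lambda>k. a k * z ^ k) sums f z" and w [measurable]: "w \<in> borel_measurable borel"
  shows "(\<integral>\<^sup>+z. ennreal ((cmod (f z))\<^sup>2) * w ((cmod z)\<^sup>2) \<partial>lborel) =
    ennreal pi * (\<Sum>k. ennreal ((cmod (a k))\<^sup>2) * (\<integral>\<^sup>+t. ennreal (t ^ k) * w t * indicator {0..} t \<partial>lborel))"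
proof -
  let ?P = unit_interval_measure
  let ?e = "\<lambda>t::real. cis (2 * pi * t)"
  interpret P: finite_measure ?P by (rule finite_measure_unit_interval)
  interpret pair_sigma_finite ?P "lborel :: complex measure" ..
  have cont: "continuous_on UNIV f"
    using entire_power_series(1)[OF a] by (rule holomorphic_on_imp_continuous_on)
  have [measurable]: "f \<in> borel_measurable borel"
    using cont by (rule borel_measurable_continuous_onI)
  have e [measurable]: "?e \<in> borel_measurable borel"
    by (intro borel_measurable_continuous_onI continuous_intros)
  have circle: "(\<integral>\<^sup>+t. ennreal ((cmod (f (?e t * z)))\<^sup>2) \<partial>?P) =
      (\<Sum>k. ennreal ((cmod (a k))\<^sup>2 * ((cmod z)\<^sup>2) ^ k))" for z
  proof -
    have "integrable ?P (\<lambda>t. (cmod (f (?e t * z)))\<^sup>2)"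
      by (rule integrable_circle[of "\<lambda>u. (cmod (f (u * z)))\<^sup>2"])
         (auto intro!: continuous_intros continuous_on_compose2[OF cont])
    then have "(\<integral>\<^sup>+t. ennreal ((cmod (f (?e t * z)))\<^sup>2) \<partial>?P) =
        ennreal (\<integral>t. (cmod (f (?e t * z)))\<^sup>2 \<partial>?P)"
      by (rule nn_integral_eq_integral) simp
    also have "\<dots> = (\<Sum>k. ennreal ((cmod (a k))\<^sup>2 * cmod z ^ (2 * k)))"
      by (rule suminf_ennreal_eq[symmetric, OF _ parseval_circle[OF a]]) simp
    finally show ?thesis by (simp add: power_mult)
  qed
  \<comment> \<open>Average over rotations, so that Parseval's identity replaces \<open>\<bar>f\<bar>\<^sup>2\<close> by a radial function.\<close>
  have "(\<integral>\<^sup>+z. ennreal ((cmod (f z))\<^sup>2) * w ((cmod z)\<^sup>2) \<partial>lborel) =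
      (\<integral>\<^sup>+t. (\<integral>\<^sup>+z. ennreal ((cmod (f z))\<^sup>2) * w ((cmod z)\<^sup>2) \<partial>lborel) \<partial>?P)"
    by (simp add: emeasure_unit_interval_UNIV)
  also have "\<dots> = (\<integral>\<^sup>+t. (\<integral>\<^sup>+z. ennreal ((cmod (f (?e t * z)))\<^sup>2) * w ((cmod z)\<^sup>2) \<partial>lborel) \<partial>?P)"
  proof (rule nn_integral_cong)
    fix t :: real
    show "(\<integral>\<^sup>+z. ennreal ((cmod (f z))\<^sup>2) * w ((cmod z)\<^sup>2) \<partial>lborel) =
        (\<integral>\<^sup>+z. ennreal ((cmod (f (?e t * z)))\<^sup>2) * w ((cmod z)\<^sup>2) \<partial>lborel)"
      using nn_integral_lborel_rotation[of "?e t" "\<lambda>z. ennreal ((cmod (f z))\<^sup>2) * w ((cmod z)\<^sup>2)"]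
      by (simp add: norm_mult)
  qed
  also have "\<dots> = (\<integral>\<^sup>+z. (\<integral>\<^sup>+t. ennreal ((cmod (f (?e t * z)))\<^sup>2) * w ((cmod z)\<^sup>2) \<partial>?P) \<partial>lborel)"
    by (rule Fubini'[symmetric]) measurable
  also have "\<dots> = (\<integral>\<^sup>+z. (\<Sum>k. ennreal ((cmod (a k))\<^sup>2 * ((cmod z)\<^sup>2) ^ k)) * w ((cmod z)\<^sup>2) \<partial>lborel)"
    by (simp add: nn_integral_multc circle)
  also have "\<dots> = ennreal pi * (\<integral>\<^sup>+t. (\<Sum>k. ennreal ((cmod (a k))\<^sup>2 * t ^ k)) * w t * indicator {0..} t \<partial>lborel)"
    by (rule nn_integral_radial[of "\<lambda>t. (\<Sum>k. ennreal ((cmod (a k))\<^sup>2 * t ^ k)) * w t"]) measurable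
  also have "(\<integral>\<^sup>+t. (\<Sum>k. ennreal ((cmod (a k))\<^sup>2 * t ^ k)) * w t * indicator {0..} t \<partial>lborel) =
      (\<integral>\<^sup>+t. (\<Sum>k. ennreal ((cmod (a k))\<^sup>2) * (ennreal (t ^ k) * w t * indicator {0..} t)) \<partial>lborel)"
  proof (rule nn_integral_cong)
    fix t :: real
    show "(\<Sum>k. ennreal ((cmod (a k))\<^sup>2 * t ^ k)) * w t * indicator {0..} t =
      (\<Sum>k. ennreal ((cmod (a k))\<^sup>2) * (ennreal (t ^ k) * w t * indicator {0..} t))"
    proof (cases "t \<ge> 0")
      case True
      then show ?thesis
        by (simp add: ennreal_mult mult.assoc[symmetric] ennreal_suminf_multc)
    qed simp
  qed
  also have "\<dots> = (\<Sum>k. \<integral>\<^sup>+t. ennreal ((cmod (a k))\<^sup>2) * (ennreal (t ^ k) * w t * indicator {0..} t) \<partial>lborel)"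
    by (rule nn_integral_suminf) measurable
  also have "\<dots> = (\<Sum>k. ennreal ((cmod (a k))\<^sup>2) * (\<integral>\<^sup>+t. ennreal (t ^ k) * w t * indicator {0..} t \<partial>lborel))"
    by (intro suminf_cong nn_integral_cmult) measurable
  finally show ?thesis .
qed

section \<open>Domination outside a disc\<close>

text \<open>Since \<open>G\<close> is not identically zero on the connected set \<open>S\<close>,
  its zeros are isolated. The quotient is bounded by 1 near each of them, so Riemann's theorem
  removes the singularities, and both the factorisation and the bound pass to the limit.\<close>

lemma holomorphic_dominated_quotient:
  assumes F: "F holomorphic_on S" and G: "G holomorphic_on S"
    and S: "open S" "connected S" and nz: "\<beta> \<in> S" "G \<beta> \<noteq> 0"
    and le: "\<And>z. z \<in> S \<Longrightarrow> cmod (F z) \<le> cmod (G z)"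
  obtains U where "U holomorphic_on S" "\<And>z. z \<in> S \<Longrightarrow> F z = U z * G z" "\<And>z. z \<in> S \<Longrightarrow> cmod (U z) \<le> 1"
proof -
  define Q where "Q z = F z / G z" for z
  define U where "U = remove_sings Q"
  have main: "U analytic_on {z} \<and> F z = U z * G z \<and> cmod (U z) \<le> 1" if z: "z \<in> S" for z
  proof -
    have ev: "\<forall>\<^sub>F w in at z. G w \<noteq> 0 \<and> w \<in> S"
      by (rule non_zero_neighbour_alt[OF G S z nz])
    then obtain d where d: "d > 0" "\<And>w. w \<noteq> z \<Longrightarrow> dist w z < d \<Longrightarrow> G w \<noteq> 0 \<and> w \<in> S"
      by (auto simp: eventually_at)
    have dS: "G w \<noteq> 0 \<and> w \<in> S" if "w \<in> ball z d - {z}" for w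
      using d(2)[of w] that by (simp add: dist_commute)
    then have "ball z d - {z} \<subseteq> S" by blast
    then have holQ: "Q holomorphic_on (ball z d - {z})"
      unfolding Q_def using dS
      by (intro holomorphic_on_divide holomorphic_on_subset[OF F] holomorphic_on_subset[OF G]) auto
    have bd: "\<forall>\<^sub>F w in at z. cmod (Q w) \<le> 1"
      using ev by eventually_elim (auto simp: Q_def norm_divide divide_le_eq le)
    obtain h where h: "h holomorphic_on ball z d" "\<And>w. w \<in> ball z d - {z} \<Longrightarrow> h w = Q w"
      using holomorphic_on_extend_bounded[OF holQ] bd d(1) by (auto simp: interior_open)
    have "isCont h z"
      using h(1) d(1) by (intro field_differentiable_imp_continuous_at
        holomorphic_on_imp_differentiable_at[of h "ball z d"]) auto
    then have "h \<midarrow>z\<rightarrow> h z" by (simp add: isCont_def)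
    moreover have "\<forall>\<^sub>F w in at z. h w = Q w"
      using d(1) h(2) by (auto simp: eventually_at dist_commute intro!: exI[of _ d])
    ultimately have lim: "Q \<midarrow>z\<rightarrow> h z" by (rule Lim_transform_eventually)
    have iso: "isolated_singularity_at Q z"
      unfolding isolated_singularity_at_def using holQ d(1)
      by (intro exI[of _ d]) (simp add: analytic_on_open open_delete)
    have Uz: "U z = h z" unfolding U_def by (rule remove_sings_eqI[OF lim])
    have "U analytic_on {z}" unfolding U_def by (rule remove_sings_analytic_at[OF iso lim])
    moreover have "cmod (U z) \<le> 1" unfolding Uz
      by (rule tendsto_upperbound[OF tendsto_norm[OF lim] bd]) simp
    moreover have "F z = U z * G z"
    proof -
      have "isCont F z" "isCont G z"
        using F G S(1) z by (auto intro!: field_differentiable_imp_continuous_at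
          holomorphic_on_imp_differentiable_at[of _ S])
      then have "F \<midarrow>z\<rightarrow> F z" and GG: "G \<midarrow>z\<rightarrow> G z" by (simp_all add: isCont_def)
      moreover have "\<forall>\<^sub>F w in at z. Q w * G w = F w"
        using ev by eventually_elim (simp add: Q_def)
      then have "F \<midarrow>z\<rightarrow> h z * G z"
        using tendsto_mult[OF lim GG] by (rule Lim_transform_eventually[rotated])
      ultimately show ?thesis
        unfolding Uz using tendsto_unique[of "at z" F] by auto
    qed
    ultimately show ?thesis by blast
  qed
  show ?thesis
  proof
    have "U analytic_on S" using main by (subst analytic_on_analytic_at) auto
    then show "U holomorphic_on S" by (rule analytic_imp_holomorphic)
  qed (use main in auto)
qed

text \<open>The inversion \<open>w = 1 / z\<close> turns the exterior of the disc into a punctured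
  disc, on which the quotient is bounded. The point at infinity becomes the puncture 0, one more
  removable singularity.\<close>

lemma entire_dominated_outside_disc:
  assumes f: "f holomorphic_on UNIV" and g: "g holomorphic_on UNIV" and R: "R > 0"
    and le: "\<And>z. cmod z > R \<Longrightarrow> cmod (f z) \<le> cmod (g z)"
  obtains U where "U holomorphic_on ball 0 (1 / R)"
    "\<And>z. cmod z > R \<Longrightarrow> f z = U (1 / z) * g z" "\<And>z. cmod z > R \<Longrightarrow> cmod (U (1 / z)) \<le> 1"
proof (cases "\<exists>z. cmod z > R \<and> g z \<noteq> 0")
  case False
  then have "f z = 0" if "cmod z > R" for z using le[OF that] that by auto
  \<comment> \<open>If \<open>g\<close> vanishes outside the disc then so does \<open>f\<close>, and
    the zero function serves as quotient.\<close>
  then show ?thesis by (intro that[of "\<lambda>_. 0"]) auto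
next
  case True
  then obtain z0 where z0: "cmod z0 > R" "g z0 \<noteq> 0" by blast
  let ?S = "ball 0 (1 / R) - {0 :: complex}"
  have inv: "cmod (1 / w) > R" if "w \<in> ?S" for w
    using that R by (simp add: norm_divide field_simps)
  have mem: "1 / z \<in> ?S" if "cmod z > R" for z
  proof -
    have "cmod z > 0" using that R by linarith
    then show ?thesis using that R by (auto simp: norm_divide divide_less_eq)
  qed
  have comp: "(\<lambda>w. h (1 / w)) holomorphic_on ?S" if "h holomorphic_on UNIV" for h
  proof -
    have "(\<lambda>w. 1 / w) holomorphic_on ?S" by (intro holomorphic_intros) auto
    from holomorphic_on_compose_gen[OF this that] show ?thesis by (simp add: o_def)
  qed
  obtain V where V: "V holomorphic_on ?S" "\<And>w. w \<in> ?S \<Longrightarrow> f (1 / w) = V w * g (1 / w)"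
    "\<And>w. w \<in> ?S \<Longrightarrow> cmod (V w) \<le> 1"
  proof (rule holomorphic_dominated_quotient[OF comp[OF f] comp[OF g]])
    show "connected ?S" by (intro connected_open_delete) auto
    show "1 / z0 \<in> ?S" by (rule mem[OF z0(1)])
    show "g (1 / (1 / z0)) \<noteq> 0" using z0 by simp
    show "cmod (f (1 / w)) \<le> cmod (g (1 / w))" if "w \<in> ?S" for w
      by (rule le[OF inv[OF that]])
  qed (auto intro: open_delete)
  \<comment> \<open>This bound near the puncture is what extends the quotient holomorphically over
    0.\<close>
  have "\<forall>\<^sub>F w in at 0. cmod (V w) \<le> 1"
    using R V(3) by (auto simp: eventually_at intro!: exI[of _ "1 / R"])
  then obtain U where U: "U holomorphic_on ball 0 (1 / R)" "\<And>w. w \<in> ?S \<Longrightarrow> U w = V w"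
    using holomorphic_on_extend_bounded[OF V(1)] R by (auto simp: interior_open)
  show ?thesis
  proof (rule that[OF U(1)])
    fix z assume z: "cmod z > R"
    then show "f z = U (1 / z) * g z" "cmod (U (1 / z)) \<le> 1"
      using V(2,3)[OF mem[OF z]] U(2)[OF mem[OF z]] by auto
  qed
qed

section \<open>Comparison of Taylor tails\<close>

text \<open>The tail of \<open>f\<close> is \<open>U (1 / z)\<close> times the tail of
  \<open>g\<close> plus an error orthogonal to the tail of \<open>f\<close>. Hence its mean square
  on the circle is at most that of the product, where \<open>\<bar>U\<bar> \<le> 1\<close>. The
  strict inequality \<open>R < r\<close> makes the auxiliary function holomorphic on a disc larger
  than the unit disc, as the mean value property requires.\<close>

lemma tail_le_circle:
  assumes a: "\<And>z. (\<lambda>k. a k * z ^ k) sums f z" and b: "\<And>z. (\<lambda>k. b k * z ^ k) sums g z"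
    and R: "0 < R" "R < r"
    and le: "\<And>z. cmod z > R \<Longrightarrow> cmod (f z) \<le> cmod (g z)"
  shows "(\<Sum>k. (cmod (if k < j then 0 else a k))\<^sup>2 * r ^ (2 * k)) \<le>
         (\<Sum>k. (cmod (if k < j then 0 else b k))\<^sup>2 * r ^ (2 * k))"
proof -
  let ?P = unit_interval_measure
  let ?e = "\<lambda>t::real. cis (2 * pi * t)"
  obtain U where U: "U holomorphic_on ball 0 (1 / R)" and fg: "\<And>z. cmod z > R \<Longrightarrow> f z = U (1 / z) * g z"
    and U1: "\<And>z. cmod z > R \<Longrightarrow> cmod (U (1 / z)) \<le> 1"
    using entire_dominated_outside_disc[OF entire_power_series(1)[OF a] entire_power_series(1)[OF b] R(1) le]
    by blast
  define tl where "tl h c z = h z - (\<Sum>k<j. c k * z ^ k)" for h :: "complex \<Rightarrow> complex" and c z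
  have tl_sums: "(\<lambda>k. (if k < j then 0 else c k) * z ^ k) sums tl h c z"
    if "\<And>z. (\<lambda>k. c k * z ^ k) sums h z" for c h z
  proof -
    have "(\<lambda>k. if k \<in> {..<j} then c k * z ^ k else 0) sums (\<Sum>k<j. c k * z ^ k)"
      by (rule sums_If_finite_set) simp
    from sums_diff[OF that[of z] this] show ?thesis
      unfolding tl_def by (rule sums_cong[THEN iffD1, rotated]) auto
  qed
  let ?F = "tl f a" and ?G = "tl g b"
  have holF: "?F holomorphic_on UNIV" and holG: "?G holomorphic_on UNIV"
    using entire_power_series(1)[OF tl_sums[OF a]] entire_power_series(1)[OF tl_sums[OF b]] by auto
  \<comment> \<open>Splitting off \<open>z ^ j\<close> from the tail leaves an entire factor; this
    power absorbs the conjugate powers of exponent below \<open>j\<close> that occur in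
    \<open>cnj v\<close>.\<close>
  define psi where "psi z = (\<Sum>k. a (k + j) * z ^ k)" for z
  have psi_sums: "(\<lambda>k. a (k + j) * z ^ k) sums psi z" for z
  proof -
    have "summable (\<lambda>k. a (k + j) * z ^ k)"
    proof (cases "z = 0")
      case False
      have "summable (\<lambda>k. a (k + j) * z ^ (k + j))"
        using a[of z] by (subst summable_iff_shift) (auto simp: sums_iff)
      then have "summable (\<lambda>k. a (k + j) * z ^ (k + j) / z ^ j)" by (rule summable_divide)
      then show ?thesis using False by (simp add: power_add)
    qed simp
    then show ?thesis by (simp add: psi_def sums_iff)
  qed
  have F_psi: "?F z = z ^ j * psi z" for z
  proof -
    have "(\<lambda>k. a (k + j) * z ^ (k + j)) sums ?F z"
      unfolding tl_def using a[of z] by (subst sums_iff_shift) simp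
    moreover have "(\<lambda>k. z ^ j * (a (k + j) * z ^ k)) sums (z ^ j * psi z)"
      by (intro sums_mult psi_sums)
    ultimately show ?thesis
      by (auto simp: power_add mult_ac dest: sums_unique2)
  qed
  \<comment> \<open>Since \<open>f = U (1 / z) g\<close>, the error \<open>v\<close> only involves powers of \<open>z\<close> below \<open>j\<close>, so it is orthogonal to
    \<open>?F\<close> on the circle: there \<open>cnj v * ?F\<close> agrees with the holomorphic function \<open>K\<close>, which
    vanishes at the origin.\<close>
  define v where "v z = ?F z - U (1 / z) * ?G z" for z
  \<comment> \<open>Here \<open>f\<close> cancels against \<open>U (1 / z) * g\<close>, so only the
    terms removed from the two series remain.\<close>
  have v_eq: "v z = (\<Sum>k<j. (U (1 / z) * b k - a k) * z ^ k)" if "cmod z > R" for z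
    using fg[OF that]
    by (simp add: v_def tl_def algebra_simps sum_subtractf sum_distrib_left)
  \<comment> \<open>Conjugating both argument and value keeps a function holomorphic. On the unit
    circle \<open>1 / (w * r)\<close> equals \<open>cnj (w / r)\<close>, so there
    \<open>Ut w\<close> is the conjugate of \<open>U (1 / (w * r))\<close>.\<close>
  define Ut where "Ut w = cnj (U (cnj (w / of_real r)))" for w
  define K where "K w = (\<Sum>k<j. (Ut w * cnj (b k) - cnj (a k)) * of_real r ^ (k + j) * w ^ (j - k)) * psi (of_real r * w)" for w
  have "Ut holomorphic_on ball 0 (r / R)"
  proof -
    have "(\<lambda>w. U (w / of_real r)) holomorphic_on ball 0 (r / R)"
    proof -
      have "(\<lambda>w. w / complex_of_real r) holomorphic_on ball 0 (r / R)"
        using R by (intro holomorphic_intros) auto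
      moreover have "(\<lambda>w. w / complex_of_real r) ` ball 0 (r / R) \<subseteq> ball 0 (1 / R)"
      proof clarify
        fix w :: complex assume "w \<in> ball 0 (r / R)"
        then have "cmod w * R < r" using R by (simp add: less_divide_eq)
        then show "w / complex_of_real r \<in> ball 0 (1 / R)" using R by (simp add: norm_divide field_simps)
      qed
      ultimately show ?thesis
        using holomorphic_on_compose_gen[OF _ U] by (simp add: o_def)
    qed
    moreover have "cnj ` ball 0 (r / R) \<subseteq> ball 0 (r / R)" by auto
    ultimately have "(\<lambda>w. U (w / of_real r)) holomorphic_on cnj ` ball 0 (r / R)"
      by (rule holomorphic_on_subset)
    from holomorphic_on_compose_cnj_cnj[OF this] show ?thesis
      by (simp add: o_def Ut_def[abs_def])
  qed
  moreover have "(\<lambda>w. psi (of_real r * w)) holomorphic_on ball 0 (r / R)"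
    using holomorphic_on_compose_gen[of "\<lambda>w. of_real r * w" "ball 0 (r / R)" psi UNIV]
      entire_power_series(1)[OF psi_sums]
    by (auto simp: o_def intro!: holomorphic_intros)
  ultimately have "K holomorphic_on ball 0 (r / R)"
    unfolding K_def[abs_def] by (intro holomorphic_intros)
  then have "(\<integral>t. K (?e t) \<partial>?P) = K 0"
    by (rule circle_mean_value) (use R in simp)
  \<comment> \<open>Every exponent \<open>j - k\<close> in the sum is positive because
    \<open>k < j\<close>.\<close>
  also have "K 0 = 0" unfolding K_def
    by (subst sum.neutral) (auto simp: power_0_left)
  finally have K0: "(\<integral>t. K (?e t) \<partial>?P) = 0" .
  have big: "cmod (?e t * of_real r) > R" for t using R by (simp add: norm_mult)
  have K_eq: "K (?e t) = cnj (v (?e t * of_real r)) * ?F (?e t * of_real r)" for t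
  proof -
    let ?c = "?e t"
    have cc: "cnj ?c * ?c = 1" by (simp add: cis_cnj cis_mult)
    have "1 / (?c * of_real r) = cnj (?c / of_real r)"
      by (simp add: cis_cnj divide_inverse cis_inverse)
    then have Ueq: "Ut ?c = cnj (U (1 / (?c * of_real r)))" by (simp add: Ut_def)
    have pow: "cnj ?c ^ k * ?c ^ j = ?c ^ (j - k)" if "k < j" for k
    proof -
      have "?c ^ j = ?c ^ k * ?c ^ (j - k)" using that by (simp flip: power_add)
      then have "cnj ?c ^ k * ?c ^ j = (cnj ?c * ?c) ^ k * ?c ^ (j - k)"
        by (simp only: power_mult_distrib mult.assoc)
      then show ?thesis by (simp only: cc power_one mult_1)
    qed
    have "cnj (v (?c * of_real r)) * ?F (?c * of_real r) =
      (\<Sum>k<j. (Ut ?c * cnj (b k) - cnj (a k)) * (cnj ?c * of_real r) ^ k * (?c * of_real r) ^ j) * psi (of_real r * ?c)"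
    proof -
      have "cnj (v (?c * of_real r)) = (\<Sum>k<j. (Ut ?c * cnj (b k) - cnj (a k)) * (cnj ?c * of_real r) ^ k)"
        unfolding v_eq[OF big] Ueq by (simp add: cis_cnj)
      then show ?thesis
        unfolding F_psi mult.commute[of "of_real r" ?c] by (simp only: sum_distrib_right mult.assoc)
    qed
    also have "(\<Sum>k<j. (Ut ?c * cnj (b k) - cnj (a k)) * (cnj ?c * of_real r) ^ k * (?c * of_real r) ^ j) =
      (\<Sum>k<j. (Ut ?c * cnj (b k) - cnj (a k)) * of_real r ^ (k + j) * ?c ^ (j - k))"
    proof (rule sum.cong[OF refl])
      fix k assume "k \<in> {..<j}"
      then show "(Ut ?c * cnj (b k) - cnj (a k)) * (cnj ?c * of_real r) ^ k * (?c * of_real r) ^ j =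
        (Ut ?c * cnj (b k) - cnj (a k)) * of_real r ^ (k + j) * ?c ^ (j - k)"
        using pow[of k] by (simp add: power_mult_distrib power_add mult_ac)
    qed
    finally show ?thesis by (simp add: K_def)
  qed
  have contF: "continuous_on UNIV ?F" and contG: "continuous_on UNIV ?G"
    using holF holG by (auto intro: holomorphic_on_imp_continuous_on)
  have intF: "integrable ?P (\<lambda>t. (cmod (?F (?e t * of_real r)))\<^sup>2)"
    and intG: "integrable ?P (\<lambda>t. (cmod (?G (?e t * of_real r)))\<^sup>2)"
    by (rule integrable_circle[of "\<lambda>u. (cmod (?F (u * of_real r)))\<^sup>2"]
             integrable_circle[of "\<lambda>u. (cmod (?G (u * of_real r)))\<^sup>2"];
        auto intro!: continuous_intros continuous_on_compose2[OF contF] continuous_on_compose2[OF contG])+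
  have "continuous_on (sphere 0 1) K"
    using \<open>K holomorphic_on _\<close> R
    by (intro continuous_on_subset[OF holomorphic_on_imp_continuous_on]) auto
  then have intK: "integrable ?P (\<lambda>t. K (?e t))" by (rule integrable_circle)
  \<comment> \<open>Expand the square of the modulus of \<open>?F - v\<close> and drop the square of
    \<open>v\<close>. The cross term is \<open>2 * Re K\<close>, which has mean zero.\<close>
  have pt: "(cmod (?F (?e t * of_real r)))\<^sup>2 - 2 * Re (K (?e t)) \<le> (cmod (?G (?e t * of_real r)))\<^sup>2" for t
  proof -
    let ?z = "?e t * of_real r"
    have sq: "(cmod x)\<^sup>2 - 2 * Re (cnj y * x) \<le> (cmod (x - y))\<^sup>2" for x y :: complex
    proof -
      have "(cmod (x - y))\<^sup>2 = (cmod x)\<^sup>2 - 2 * Re (cnj y * x) + (cmod y)\<^sup>2"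
        unfolding cmod_power2 by (simp add: power2_eq_square algebra_simps)
      then show ?thesis by simp
    qed
    have "?F ?z - v ?z = U (1 / ?z) * ?G ?z" by (simp add: v_def)
    then have "(cmod (?F ?z - v ?z))\<^sup>2 \<le> (cmod (?G ?z))\<^sup>2"
      using U1[OF big[of t]] by (intro power_mono) (auto simp: norm_mult intro: mult_left_le_one_le)
    with sq[of "?F ?z" "v ?z"] show ?thesis unfolding K_eq by (rule order_trans)
  qed
  have "(\<integral>t. (cmod (?F (?e t * of_real r)))\<^sup>2 \<partial>?P) =
     (\<integral>t. (cmod (?F (?e t * of_real r)))\<^sup>2 - 2 * Re (K (?e t)) \<partial>?P)"
    using intF intK K0 by (simp add: integral_Re)
  also have "\<dots> \<le> (\<integral>t. (cmod (?G (?e t * of_real r)))\<^sup>2 \<partial>?P)"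
    using intF intG intK pt by (intro integral_mono) auto
  finally show ?thesis
    using parseval_circle[OF tl_sums[OF a], of "of_real r"] parseval_circle[OF tl_sums[OF b], of "of_real r"] R
    by (simp add: sums_iff)
qed

text \<open>The circle inequality is carried to \<open>r = R\<close> by a limit from the right. On
  the left a finite partial sum with radius \<open>R\<close> already bounds from below, so only the
  right side, a power series in the squared radius, has to be continuous.\<close>

lemma tail_le:
  assumes a: "\<And>z. (\<lambda>k. a k * z ^ k) sums f z" and b: "\<And>z. (\<lambda>k. b k * z ^ k) sums g z"
    and R: "0 < R"
    and le: "\<And>z. cmod z > R \<Longrightarrow> cmod (f z) \<le> cmod (g z)"
  shows "(\<Sum>k\<in>{j..<n}. (cmod (a k))\<^sup>2 * R ^ (2 * k)) \<le>
         (\<Sum>k. if k < j then 0 else (cmod (b k))\<^sup>2 * R ^ (2 * k))"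
proof -
  define \<beta> where "\<beta> k = (cmod (if k < j then 0 else b k))\<^sup>2" for k
  define \<Phi> where "\<Phi> t = (\<Sum>k. \<beta> k * t ^ k)" for t :: real
  have sq_summable: "summable (\<lambda>k. (cmod (c k))\<^sup>2 * r ^ (2 * k))"
    if "\<And>z. (\<lambda>k. c k * z ^ k) sums h z" "r \<ge> 0" for c h and r :: real
    using parseval_circle[OF that(1), of "of_real r"] that(2) by (auto simp: sums_iff)
  have restrict: "summable (\<lambda>k. (cmod (if k < j then 0 else c k))\<^sup>2 * r ^ (2 * k))"
    if "\<And>z. (\<lambda>k. c k * z ^ k) sums h z" "r \<ge> 0" for c h and r :: real
    by (rule summable_comparison_test'[OF sq_summable[OF that], of 0]) (use that(2) in auto)
  have "(\<Sum>k\<in>{j..<n}. (cmod (a k))\<^sup>2 * R ^ (2 * k)) \<le> \<Phi> (r\<^sup>2)" if r: "r > R" for r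
  proof -
    have "(\<Sum>k\<in>{j..<n}. (cmod (a k))\<^sup>2 * R ^ (2 * k)) \<le>
        (\<Sum>k\<in>{j..<n}. (cmod (if k < j then 0 else a k))\<^sup>2 * r ^ (2 * k))"
      using R r by (intro sum_mono) (auto intro!: mult_left_mono power_mono)
    also have "\<dots> \<le> (\<Sum>k. (cmod (if k < j then 0 else a k))\<^sup>2 * r ^ (2 * k))"
      using R r by (intro sum_le_suminf restrict[OF a]) auto
    also have "\<dots> \<le> (\<Sum>k. (cmod (if k < j then 0 else b k))\<^sup>2 * r ^ (2 * k))"
      by (rule tail_le_circle[OF a b R r le])
    finally show ?thesis by (simp add: \<Phi>_def \<beta>_def power_mult)
  qed
  then have "\<forall>\<^sub>F r in at_right R. (\<Sum>k\<in>{j..<n}. (cmod (a k))\<^sup>2 * R ^ (2 * k)) \<le> \<Phi> (r\<^sup>2)"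
    by (auto simp: eventually_at_filter)
  moreover have "((\<lambda>r. \<Phi> (r\<^sup>2)) \<longlongrightarrow> \<Phi> (R\<^sup>2)) (at_right R)"
  proof -
    \<comment> \<open>Convergence at \<open>(R + 1)\<^sup>2\<close> puts \<open>R\<^sup>2\<close>
      strictly inside the disc of convergence.\<close>
    have "summable (\<lambda>k. \<beta> k * ((R + 1)\<^sup>2) ^ k)"
      using restrict[OF b, of "R + 1"] R by (simp add: \<beta>_def power_mult)
    moreover have "norm (R\<^sup>2) < norm ((R + 1)\<^sup>2)"
      using R by (auto intro!: power_strict_mono)
    ultimately have "isCont \<Phi> (R\<^sup>2)"
      unfolding \<Phi>_def[abs_def] by (rule isCont_powser)
    then show ?thesis
      by (rule isCont_tendsto_compose) (intro tendsto_intros)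
  qed
  ultimately have "(\<Sum>k\<in>{j..<n}. (cmod (a k))\<^sup>2 * R ^ (2 * k)) \<le> \<Phi> (R\<^sup>2)"
    by (intro tendsto_lowerbound) auto
  also have "\<Phi> (R\<^sup>2) = (\<Sum>k. if k < j then 0 else (cmod (b k))\<^sup>2 * R ^ (2 * k))"
    unfolding \<Phi>_def \<beta>_def by (intro suminf_cong) (simp add: power_mult)
  finally show ?thesis .
qed

text \<open>Abel summation: a non-decreasing weight is a non-negative combination of tail indicators.\<close>

lemma weighted_sum_le_of_tails:
  fixes \<alpha> \<beta> w :: "nat \<Rightarrow> real"
  assumes w: "0 \<le> w 0" "\<And>k. w k \<le> w (Suc k)" and \<beta>: "\<And>k. 0 \<le> \<beta> k" "summable \<beta>"
    and w\<beta>: "summable (\<lambda>k. w k * \<beta> k)"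
    and tails: "\<And>j. (\<Sum>k\<in>{j..<n}. \<alpha> k) \<le> (\<Sum>k. if k < j then 0 else \<beta> k)"
  shows "(\<Sum>k<n. w k * \<alpha> k) \<le> (\<Sum>k. w k * \<beta> k)"
proof -
  \<comment> \<open>The increments of \<open>w\<close>, with \<open>w 0\<close> counted as an
    increment from zero; all are non-negative and their partial sums return
    \<open>w\<close>.\<close>
  define d where "d j = (case j of 0 \<Rightarrow> w 0 | Suc i \<Rightarrow> w (Suc i) - w i)" for j
  have d0: "0 \<le> d j" for j using w by (simp add: d_def split: nat.split)
  have w_eq: "w k = (\<Sum>j\<le>k. d j)" for k by (induction k) (auto simp: d_def)
  have summ: "summable (\<lambda>k. d j * (if k < j then 0 else \<beta> k))" for j
    by (intro summable_mult summable_comparison_test'[OF \<beta>(2), of 0]) (use \<beta> in auto)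
  have "(\<Sum>k<n. w k * \<alpha> k) = (\<Sum>j<n. d j * (\<Sum>k\<in>{j..<n}. \<alpha> k))"
  proof (induction n)
    case (Suc n)
    have "(\<Sum>j<Suc n. d j * (\<Sum>k\<in>{j..<Suc n}. \<alpha> k)) =
        (\<Sum>j<Suc n. d j * (\<Sum>k\<in>{j..<n}. \<alpha> k) + d j * \<alpha> n)"
      by (intro sum.cong) (auto simp: algebra_simps)
    also have "\<dots> = (\<Sum>j<n. d j * (\<Sum>k\<in>{j..<n}. \<alpha> k)) + (\<Sum>j\<le>n. d j) * \<alpha> n"
      by (simp add: sum.distrib sum_distrib_right lessThan_Suc_atMost[symmetric])
         (simp add: distrib_right sum_distrib_right)
    finally show ?case using Suc by (simp add: w_eq)
  qed simp
  also have "\<dots> \<le> (\<Sum>j<n. d j * (\<Sum>k. if k < j then 0 else \<beta> k))"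
    by (intro sum_mono mult_left_mono tails d0)
  also have "\<dots> = (\<Sum>j<n. \<Sum>k. d j * (if k < j then 0 else \<beta> k))"
    by (intro sum.cong suminf_mult[symmetric] summable_comparison_test'[OF \<beta>(2), of 0]) (use \<beta> in auto)
  also have "\<dots> = (\<Sum>k. \<Sum>j<n. d j * (if k < j then 0 else \<beta> k))"
    by (rule suminf_sum[symmetric]) (rule summ)
  \<comment> \<open>For each \<open>k\<close> the left side collects the increments with
    \<open>j \<le> k\<close> and \<open>j < n\<close>; adding the missing non-negative ones gives
    \<open>w k\<close>.\<close>
  also have "\<dots> \<le> (\<Sum>k. w k * \<beta> k)"
  proof (rule suminf_le[OF _ summable_sum w\<beta>])
    fix k
    have "(\<Sum>j<n. d j * (if k < j then 0 else \<beta> k)) = (\<Sum>j\<in>{..<n} \<inter> {..k}. d j * \<beta> k)"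
      by (intro sum.mono_neutral_cong_right) auto
    also have "\<dots> \<le> (\<Sum>j\<le>k. d j * \<beta> k)"
      using d0 \<beta>(1) by (intro sum_mono2) auto
    finally show "(\<Sum>j<n. d j * (if k < j then 0 else \<beta> k)) \<le> w k * \<beta> k"
      by (simp add: w_eq sum_distrib_right)
  qed (rule summ)
  finally show ?thesis .
qed

section \<open>Radial weights\<close>

lemma weight_moment_nonneg:
  assumes "radial_weight W"
  shows "0 \<le> weight_moment W k"
proof -
  have "0 \<le> W t" if "t \<ge> 0" for t using assms that by (simp add: radial_weight_def)
  then show ?thesis
    unfolding weight_moment_def
    by (intro integral_nonneg_AE AE_I2) (auto intro!: mult_nonneg_nonneg simp: space_restrict_space)
qed

text \<open>A vanishing moment would make \<open>t ^ k * W t\<close> zero almost everywhere. The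
  point 0, where the power may vanish, is a null set, so \<open>W\<close> itself would be zero
  almost everywhere.\<close>

lemma weight_moment_pos:
  assumes "radial_weight W"
  shows "0 < weight_moment W k"
proof (rule ccontr)
  assume "\<not> 0 < weight_moment W k"
  then have "weight_moment W k = 0" using weight_moment_nonneg[OF assms, of k] by simp
  moreover have int: "integrable (lebesgue_on {0..}) (\<lambda>t. t ^ k * W t)"
    using assms by (simp add: radial_weight_def)
  moreover have "AE t in lebesgue_on {0..}. 0 \<le> t ^ k * W t"
    using assms by (intro AE_I2 mult_nonneg_nonneg) (simp_all add: radial_weight_def space_restrict_space)
  ultimately have "AE t in lebesgue_on {0..}. t ^ k * W t = 0"
    unfolding weight_moment_def using integral_nonneg_eq_0_iff_AE[OF int] by blast
  moreover have "AE t in lebesgue_on {0..}. t \<noteq> (0::real)"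
  proof -
    have "AE t in lebesgue. t \<noteq> (0::real)" by (intro AE_completion AE_lborel_singleton)
    then show ?thesis by (subst AE_restrict_space_iff) auto
  qed
  ultimately have "AE t in lebesgue_on {0..}. W t = 0" by eventually_elim auto
  then show False using assms by (simp add: radial_weight_def)
qed

text \<open>Chebyshev's argument: \<open>t - c\<close> and \<open>t ^ k - c ^ k\<close> have the
  same sign, so their product integrates against \<open>W\<close> to something non-negative. The
  choice \<open>c = m_1 / m_0\<close> makes the integral of \<open>(t - c) * W t\<close> vanish,
  which removes the term with \<open>c ^ k\<close>.\<close>

lemma weight_moment_Suc_ge:
  assumes "radial_weight W"
  shows "weight_moment W 1 / weight_moment W 0 * weight_moment W k \<le> weight_moment W (Suc k)"
proof -
  define c where "c = weight_moment W 1 / weight_moment W 0"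
  have c: "c * weight_moment W 0 = weight_moment W 1" "c \<ge> 0"
    using weight_moment_pos[OF assms, of 0] weight_moment_nonneg[OF assms, of 1] by (simp_all add: c_def)
  have int: "integrable (lebesgue_on {0..}) (\<lambda>t. t ^ k * W t)" for k
    using assms by (auto simp: radial_weight_def)
  have int0: "integrable (lebesgue_on {0..}) W" and int1: "integrable (lebesgue_on {0..}) (\<lambda>t. t * W t)"
    using int[of 0] int[of 1] by simp_all
  have intS: "integrable (lebesgue_on {0..}) (\<lambda>t. t * t ^ k * W t)" using int[of "Suc k"] by simp
  have "0 = (\<integral>t. c ^ k * (t * W t) - c ^ k * (c * W t) \<partial>lebesgue_on {0..})"
    using int0 int1 c(1) by (simp add: weight_moment_def)
  also have "\<dots> \<le> (\<integral>t. t * t ^ k * W t - c * (t ^ k * W t) \<partial>lebesgue_on {0..})"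
  proof (rule integral_mono)
    fix t :: real assume "t \<in> space (lebesgue_on {0..})"
    then have t: "t \<ge> 0" by (simp add: space_restrict_space)
    have "0 \<le> (t - c) * (t ^ k - c ^ k)"
    proof (cases "t \<ge> c")
      case True
      then show ?thesis using c(2) by (intro mult_nonneg_nonneg) (auto intro: power_mono)
    next
      case False
      then show ?thesis using t by (intro mult_nonpos_nonpos) (auto intro: power_mono)
    qed
    moreover have "0 \<le> W t" using assms t by (simp add: radial_weight_def)
    ultimately have "0 \<le> (t - c) * (t ^ k - c ^ k) * W t" by (rule mult_nonneg_nonneg)
    then show "c ^ k * (t * W t) - c ^ k * (c * W t) \<le> t * t ^ k * W t - c * (t ^ k * W t)"
      by (simp add: algebra_simps)
  qed (use int0 int1 intS int in auto)
  also have "\<dots> = weight_moment W (Suc k) - c * weight_moment W k"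
    using intS int by (simp add: weight_moment_def)
  finally show ?thesis by (simp add: c_def)
qed

text \<open>Monotonicity supplies Borel measurability, which survives composition with the squared
  modulus. It is assumed only on the open half-line, so the value at 0 is added as a separate
  term.\<close>

lemma borel_measurable_antimono_weight:
  fixes W :: "real \<Rightarrow> real"
  assumes "antimono_on {0<..} W"
  shows "(\<lambda>t. if t < 0 then 0 else W t) \<in> borel_measurable borel"
proof -
  have "mono_on {0<..} (\<lambda>t. - W t)"
    using assms by (auto simp: monotone_on_def)
  then have "(\<lambda>t. - W t) \<in> borel_measurable (restrict_space borel {0<..})"
    by (rule borel_measurable_mono_on_fnc)
  then have "(\<lambda>t. indicator {0<..} t *\<^sub>R - W t) \<in> borel_measurable borel"
    by (subst (asm) borel_measurable_restrict_space_iff) auto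
  then have "(\<lambda>t. - (indicator {0<..} t *\<^sub>R - W t) + W 0 * indicator {0} t) \<in> borel_measurable borel"
    by measurable
  also have "(\<lambda>t. - (indicator {0<..} t *\<^sub>R - W t) + W 0 * indicator {0} t) = (\<lambda>t. if t < 0 then 0 else W t)"
    by (auto simp: fun_eq_iff indicator_def)
  finally show ?thesis .
qed

section \<open>The weighted norm in Taylor coefficients\<close>

lemma nn_integral_entire_weight:
  assumes W: "radial_weight W" "antimono_on {0<..} W" and a: "\<And>z. (\<lambda>k. a k * z ^ k) sums f z"
  shows "(\<integral>\<^sup>+z. ennreal ((cmod (f z))\<^sup>2 * W ((cmod z)\<^sup>2)) \<partial>lebesgue) =
      ennreal pi * (\<Sum>k. ennreal ((cmod (a k))\<^sup>2 * weight_moment W k))"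
    and "(\<lambda>z. (cmod (f z))\<^sup>2 * W ((cmod z)\<^sup>2)) \<in> borel_measurable lborel"
proof -
  \<comment> \<open>\<open>W\<close> is unconstrained on negative arguments, so it need not be Borel measurable.\<close>
  define V where "V t = (if t < 0 then 0 else W t)" for t
  have V [measurable]: "V \<in> borel_measurable borel"
    unfolding V_def[abs_def] by (rule borel_measurable_antimono_weight[OF W(2)])
  have V_sq [simp]: "V (x\<^sup>2) = W (x\<^sup>2)" for x by (simp add: V_def not_less)
  have W0: "0 \<le> W t" if "t \<ge> 0" for t using W(1) that by (auto simp: radial_weight_def)
  have "continuous_on UNIV f"
    using entire_power_series(1)[OF a] by (rule holomorphic_on_imp_continuous_on)
  then have [measurable]: "f \<in> borel_measurable borel" by (rule borel_measurable_continuous_onI)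
  have "(\<lambda>z. (cmod (f z))\<^sup>2 * V ((cmod z)\<^sup>2)) \<in> borel_measurable lborel" by measurable
  then show "(\<lambda>z. (cmod (f z))\<^sup>2 * W ((cmod z)\<^sup>2)) \<in> borel_measurable lborel" by simp
  have moment: "(\<integral>\<^sup>+t. ennreal (t ^ k) * ennreal (V t) * indicator {0..} t \<partial>lborel) = ennreal (weight_moment W k)" for k
  proof -
    have "integrable (lebesgue_on {0..}) (\<lambda>t. t ^ k * W t)"
      using W(1) by (auto simp: radial_weight_def)
    then have "ennreal (weight_moment W k) = (\<integral>\<^sup>+t. ennreal (t ^ k * W t) \<partial>lebesgue_on {0..})"
      unfolding weight_moment_def
      by (intro nn_integral_eq_integral[symmetric]) (auto intro!: AE_I2 W0 mult_nonneg_nonneg simp: space_restrict_space)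
    also have "\<dots> = (\<integral>\<^sup>+t. ennreal (t ^ k * W t) * indicator {0..} t \<partial>lebesgue)"
      by (subst nn_integral_restrict_space) auto
    \<comment> \<open>Completion does not change a non-negative integral, so the Lebesgue moment can
      be computed with \<open>lborel\<close>.\<close>
    also have "\<dots> = (\<integral>\<^sup>+t. ennreal (t ^ k) * ennreal (V t) * indicator {0..} t \<partial>lborel)"
      unfolding nn_integral_completion
      by (intro nn_integral_cong) (auto simp: V_def ennreal_mult W0 indicator_def)
    finally show ?thesis ..
  qed
  have "(\<integral>\<^sup>+z. ennreal ((cmod (f z))\<^sup>2 * W ((cmod z)\<^sup>2)) \<partial>lebesgue) =
      (\<integral>\<^sup>+z. ennreal ((cmod (f z))\<^sup>2) * ennreal (V ((cmod z)\<^sup>2)) \<partial>lborel)"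
    unfolding nn_integral_completion by (intro nn_integral_cong) (simp add: ennreal_mult W0)
  also have "\<dots> = ennreal pi * (\<Sum>k. ennreal ((cmod (a k))\<^sup>2) * ennreal (weight_moment W k))"
    by (subst nn_integral_entire_radial[OF a]) (simp_all only: moment, measurable)
  finally show "(\<integral>\<^sup>+z. ennreal ((cmod (f z))\<^sup>2 * W ((cmod z)\<^sup>2)) \<partial>lebesgue) =
      ennreal pi * (\<Sum>k. ennreal ((cmod (a k))\<^sup>2 * weight_moment W k))"
    by (simp add: ennreal_mult weight_moment_nonneg[OF W(1)])
qed

lemma fock_space_iff_summable:
  assumes W: "radial_weight W" "antimono_on {0<..} W" and a: "\<And>z. (\<lambda>k. a k * z ^ k) sums f z"
  shows "f \<in> fock_space W \<longleftrightarrow> summable (\<lambda>k. (cmod (a k))\<^sup>2 * weight_moment W k)"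
proof -
  have nonneg: "0 \<le> (cmod (a k))\<^sup>2 * weight_moment W k" for k
    using weight_moment_nonneg[OF W(1)] by simp
  have W0: "0 \<le> W (x\<^sup>2)" for x using W(1) by (auto simp: radial_weight_def)
  have "f \<in> fock_space W \<longleftrightarrow> (\<integral>\<^sup>+z. ennreal ((cmod (f z))\<^sup>2 * W ((cmod z)\<^sup>2)) \<partial>lebesgue) < \<infinity>"
    using measurable_completion[OF nn_integral_entire_weight(2)[OF W a]] entire_power_series(1)[OF a]
    by (simp add: fock_space_def integrable_iff_bounded abs_mult W0)
  also have "\<dots> \<longleftrightarrow> (\<Sum>k. ennreal ((cmod (a k))\<^sup>2 * weight_moment W k)) < \<infinity>"
    by (auto simp: nn_integral_entire_weight(1)[OF W a] ennreal_mult_less_top)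
  also have "\<dots> \<longleftrightarrow> summable (\<lambda>k. (cmod (a k))\<^sup>2 * weight_moment W k)"
  proof
    assume "(\<Sum>k. ennreal ((cmod (a k))\<^sup>2 * weight_moment W k)) < \<infinity>"
    then show "summable (\<lambda>k. (cmod (a k))\<^sup>2 * weight_moment W k)"
      by (intro summable_suminf_not_top[OF nonneg]) simp
  next
    assume "summable (\<lambda>k. (cmod (a k))\<^sup>2 * weight_moment W k)"
    from suminf_ennreal2[OF nonneg this]
    show "(\<Sum>k. ennreal ((cmod (a k))\<^sup>2 * weight_moment W k)) < \<infinity>" by simp
  qed
  finally show ?thesis .
qed

lemma fock_norm_power_series:
  assumes W: "radial_weight W" "antimono_on {0<..} W" and a: "\<And>z. (\<lambda>k. a k * z ^ k) sums f z"
    and f: "f \<in> fock_space W"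
  shows "fock_norm W f = sqrt (\<Sum>k. (cmod (a k))\<^sup>2 * weight_moment W k)"
proof -
  let ?S = "\<Sum>k. (cmod (a k))\<^sup>2 * weight_moment W k"
  have summ: "summable (\<lambda>k. (cmod (a k))\<^sup>2 * weight_moment W k)"
    using f fock_space_iff_summable[OF W a] by simp
  have nonneg: "0 \<le> (cmod (a k))\<^sup>2 * weight_moment W k" for k
    using weight_moment_nonneg[OF W(1)] by simp
  have "(\<integral>z. (cmod (f z))\<^sup>2 * W ((cmod z)\<^sup>2) \<partial>lebesgue) =
      enn2real (\<integral>\<^sup>+z. ennreal ((cmod (f z))\<^sup>2 * W ((cmod z)\<^sup>2)) \<partial>lebesgue)"
    using W(1) by (intro integral_eq_nn_integral measurable_completion nn_integral_entire_weight(2)[OF W a])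
      (auto simp: radial_weight_def)
  also have "\<dots> = enn2real (ennreal pi * ennreal ?S)"
    by (simp only: nn_integral_entire_weight(1)[OF W a] suminf_ennreal2[OF nonneg summ])
  also have "\<dots> = pi * ?S"
    using suminf_nonneg[OF summ nonneg] by (simp flip: ennreal_mult)
  finally show ?thesis by (simp add: fock_norm_def)
qed

theorem theorem1p3:
  fixes W :: "real \<Rightarrow> real"
  assumes "radial_weight W"
    and "antimono_on {0<..} W"
  shows "korenblum_radius W = ereal (sqrt (weight_moment W 1 / weight_moment W 0))
       \<and> admissible_radius W (sqrt (weight_moment W 1 / weight_moment W 0))"
proof -
  let ?m = "weight_moment W"
  define R where "R = sqrt (?m 1 / ?m 0)"
  have m_pos: "0 < ?m k" for k by (rule weight_moment_pos[OF assms(1)])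
  have R: "R > 0" and R2: "R\<^sup>2 = ?m 1 / ?m 0"
    using m_pos[of 0] m_pos[of 1] by (simp_all add: R_def)
  have admissible: "admissible_radius W R"
    unfolding admissible_radius_def
  proof (intro conjI R ballI impI)
    fix f g
    assume f: "f \<in> fock_space W" and g: "g \<in> fock_space W"
      and le: "\<forall>z. R < cmod z \<longrightarrow> cmod (f z) \<le> cmod (g z)"
    have power_series: "\<exists>a. \<forall>z. (\<lambda>k. a k * z ^ k) sums h z" if "h holomorphic_on UNIV" for h :: "complex \<Rightarrow> complex"
    proof (intro exI allI)
      fix z
      have "(\<lambda>k. (deriv ^^ k) h 0 / fact k * (z - 0) ^ k) sums h z"
        by (rule holomorphic_power_series[of h 0 "cmod z + 1"]) (use that in \<open>auto intro: holomorphic_on_subset\<close>)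
      then show "(\<lambda>k. (deriv ^^ k) h 0 / fact k * z ^ k) sums h z" by simp
    qed
    obtain a where a: "\<And>z. (\<lambda>k. a k * z ^ k) sums f z"
      using power_series f by (auto simp: fock_space_def)
    obtain b where b: "\<And>z. (\<lambda>k. b k * z ^ k) sums g z"
      using power_series g by (auto simp: fock_space_def)
    have sa: "summable (\<lambda>k. (cmod (a k))\<^sup>2 * ?m k)" and sb: "summable (\<lambda>k. (cmod (b k))\<^sup>2 * ?m k)"
      using f g fock_space_iff_summable[OF assms a] fock_space_iff_summable[OF assms b] by simp_all
    \<comment> \<open>Rescaling moves \<open>R ^ (2 * k)\<close> from the moments to the
      coefficients: the tail inequalities hold with this factor, and the remaining weight
      \<open>w\<close> is non-decreasing by the moment inequality.\<close>
    define w where "w k = ?m k / R ^ (2 * k)" for k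
    have w_mult: "w k * (x * R ^ (2 * k)) = x * ?m k" for k x using R by (simp add: w_def)
    have "(\<Sum>k<n. w k * ((cmod (a k))\<^sup>2 * R ^ (2 * k))) \<le> (\<Sum>k. w k * ((cmod (b k))\<^sup>2 * R ^ (2 * k)))" for n
    proof (rule weighted_sum_le_of_tails)
      show "0 \<le> w 0" using m_pos[of 0] by (simp add: w_def)
      show "w k \<le> w (Suc k)" for k
      proof -
        have "R\<^sup>2 * ?m k \<le> ?m (Suc k)"
          unfolding R2 by (rule weight_moment_Suc_ge[OF assms(1)])
        then show ?thesis using R by (simp add: w_def field_simps power2_eq_square)
      qed
      show "summable (\<lambda>k. (cmod (b k))\<^sup>2 * R ^ (2 * k))"
        using parseval_circle[OF b, of "of_real R"] R by (simp add: sums_iff)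
      show "summable (\<lambda>k. w k * ((cmod (b k))\<^sup>2 * R ^ (2 * k)))" using sb by (simp add: w_mult)
      show "(\<Sum>k = j..<n. (cmod (a k))\<^sup>2 * R ^ (2 * k)) \<le> (\<Sum>k. if k < j then 0 else (cmod (b k))\<^sup>2 * R ^ (2 * k))" for j
        by (rule tail_le[OF a b R]) (use le in auto)
    qed (use R in auto)
    then have "(\<Sum>k. (cmod (a k))\<^sup>2 * ?m k) \<le> (\<Sum>k. (cmod (b k))\<^sup>2 * ?m k)"
      unfolding w_mult by (rule suminf_le_const[OF sa])
    then show "fock_norm W f \<le> fock_norm W g"
      by (simp add: fock_norm_power_series[OF assms a f] fock_norm_power_series[OF assms b g])
  qed
  have upper: "r \<le> R" if "admissible_radius W r" for r
  proof -
    have r: "r > 0" using that by (simp add: admissible_radius_def)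
    \<comment> \<open>The test pair is the constant \<open>r\<close> and the identity: the constant
      is dominated wherever the modulus exceeds \<open>r\<close>, and the squared norms are
      \<open>r\<^sup>2 * ?m 0\<close> and \<open>?m 1\<close>.\<close>
    let ?a = "\<lambda>k::nat. if k = 0 then complex_of_real r else 0"
    let ?b = "\<lambda>k::nat. if k = 1 then 1 else 0 :: complex"
    have a: "(\<lambda>k. ?a k * z ^ k) sums of_real r" and b: "(\<lambda>k. ?b k * z ^ k) sums z" for z
      using sums_single[of 0 "\<lambda>k. of_real r * z ^ k"] sums_single[of 1 "\<lambda>k. z ^ k"]
      by (simp_all add: if_distrib[of "\<lambda>x. x * _"] cong: if_cong)
    have na: "(\<lambda>k. (cmod (?a k))\<^sup>2 * ?m k) sums (r\<^sup>2 * ?m 0)"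
      and nb: "(\<lambda>k. (cmod (?b k))\<^sup>2 * ?m k) sums ?m 1"
      using sums_single[of 0 "\<lambda>k. r\<^sup>2 * ?m k"] sums_single[of 1 ?m]
      by (auto simp: if_distrib[of "\<lambda>x. (cmod x)\<^sup>2 * _"] cong: if_cong)
    have fock: "(\<lambda>z. of_real r) \<in> fock_space W" "(\<lambda>z. z) \<in> fock_space W"
      using fock_space_iff_summable[OF assms a] fock_space_iff_summable[OF assms b] na nb
      by (auto simp: sums_iff)
    have "fock_norm W (\<lambda>z. of_real r) \<le> fock_norm W (\<lambda>z. z)"
      using that fock r unfolding admissible_radius_def by fastforce
    then have "r\<^sup>2 * ?m 0 \<le> ?m 1"
      using na nb fock_norm_power_series[OF assms a fock(1)] fock_norm_power_series[OF assms b fock(2)]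
      by (simp add: sums_iff)
    then have "r\<^sup>2 \<le> R\<^sup>2" using m_pos[of 0] by (simp add: R2 field_simps)
    then show ?thesis by (rule power2_le_imp_le) (use R in simp)
  qed
  \<comment> \<open>\<open>R\<close> bounds all admissible radii and is itself admissible, so the
    supremum is attained.\<close>
  have "korenblum_radius W = ereal R"
    unfolding korenblum_radius_def
  proof (rule antisym)
    show "(SUP r\<in>{r. admissible_radius W r}. ereal r) \<le> ereal R"
      by (rule SUP_least) (simp add: upper)
    show "ereal R \<le> (SUP r\<in>{r. admissible_radius W r}. ereal r)"
      by (rule SUP_upper) (simp add: admissible)
  qed
  with admissible show ?thesis by (simp add: R_def)
qed

end
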